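(* Assume $w^*=\inf_{x\in\mathbb{X}}w(x)<+\infty$. If there exist a measurable function $u:\mathbb{X}\to[0,+\infty)$ and a stationary policy $\phi$ such that $$\overline{w}+u(x)\ \ge\ c(x,\phi(x))+\int_{\mathbb{X}}u(y)\,q(dy|x,\phi(x)),\qquad x\in\mathbb{X},$$ then $\phi$ is average-cost optimal and $$w(x)=w^{\phi}(x)=\limsup_{\alpha\uparrow1}(1-\alpha)v_\alpha(x)=\overline{w}=w^*,\qquad x\in\mathbb{X}.$$
   Context: **MDP.** The state space $\mathbb{X}$ and the action space $\mathbb{A}$ are Borel subsets of Polish spaces. For each $x\in\mathbb{X}$ a nonempty Borel set $A(x)\subseteq\mathbb{A}$ of available actions is given; $\mathrm{Gr}(A)=\{(x,a):x\in\mathbb{X},a\in A(x)\}$ is a Borel subset of $\mathbb{X}\times\mathbb{A}$, and there exists a Borel map $\phi:\mathbb{X}\to\mathbb{A}$ with $\phi(x)\in A(x)$ for all $x$. The one-step cost $c:\mathrm{Gr}(A)\to(-\infty,+\infty]$ is Borel and bounded below. The transition kernel $q$ is such that $q(\cdot|x,a)$ is a Borel probability measure on $\mathbb{X}$ for each $(x,a)$ and $q(B|\cdot,\cdot)$ is Borel on $\mathrm{Gr}(A)$ for each Borel $B\subseteq\mathbb{X}$. **Policies.** A policy $\pi=\{\pi_n\}_{n\ge0}$ is a sequence of regular transition probabilities $\pi_n$ from histories $h_n=(\xi_0,u_0,\dots,u_{n-1},\xi_n)\in(\mathbb{X}\times\mathbb{A})^n\times\mathbb{X}$ to $\mathbb{A}$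 with $\pi_n(A(\xi_n)|h_n)=1$; $\Pi$ is the set of all policies. A stationary policy is a Borel map $\phi:\mathbb{X}\to\mathbb{A}$ with $\phi(x)\in A(x)$ for all $x$ (the action $\phi(\xi_n)$ is used at every time $n$). An initial state $x$ and a policy $\pi$ define a probability $P_x^\pi$ on trajectories $(\xi_0,u_0,\xi_1,u_1,\dots)$ with expectation $\mathbb{E}_x^\pi$. **Costs.** $v_N^\pi(x)=\mathbb{E}_x^\pi\sum_{n=0}^{N-1}c(\xi_n,u_n)$; for $\alpha\in[0,1)$, $v_\alpha^\pi(x)=\mathbb{E}_x^\pi\sum_{n=0}^{\infty}\alpha^n c(\xi_n,u_n)$ (with $\alpha^0=1$); $w^\pi(x)=\limsup_{N\to\infty}\frac1N v_N^\pi(x)$. Optimal values: $v_\alpha(x)=\inf_{\pi\in\Pi}v_\alpha^\pi(x)$, $w(x)=\inf_{\pi\in\Pi}w^\pi(x)$. A policy $\pi$ is average-cost optimal if $w^\pi(x)=w(x)$ for all $x\in\mathbb{X}$. For $\alpha\in[0,1)$, $m_\alpha=\inf_{x\in\mathbb{X}}v_\alpha(x)$, and $\overline{w}=\limsup_{\alpha\uparrow1}(1-\alpha)m_\alpha$. *)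

theory Defs
  imports "HOL-Probability.Probability"
begin

section \<open>Borel Markov decision processes\<close>

record ('x, 'a) mdp =
  states  :: "'x set"
  actions :: "'a set"
  avail   :: "'x \<Rightarrow> 'a set"
  cost    :: "'x \<times> 'a \<Rightarrow> ereal"
  kernel  :: "'x \<times> 'a \<Rightarrow> 'x measure"

definition state_space :: "('x::topological_space, 'a, 'z) mdp_scheme \<Rightarrow> 'x measure" where
  "state_space D = restrict_space borel (states D)"

definition action_space :: "('x, 'a::topological_space, 'z) mdp_scheme \<Rightarrow> 'a measure" where
  "action_space D = restrict_space borel (actions D)"

definition step_space ::
  "('x::topological_space, 'a::topological_space, 'z) mdp_scheme \<Rightarrow> ('x \<times> 'a) measure" where
  "step_space D = state_space D \<Otimes>\<^sub>M action_space D"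

definition graph :: "('x, 'a, 'z) mdp_scheme \<Rightarrow> ('x \<times> 'a) set" where
  "graph D = {(x, a). x \<in> states D \<and> a \<in> avail D x}"

definition stationary_policy ::
  "('x::topological_space, 'a::topological_space, 'z) mdp_scheme \<Rightarrow> ('x \<Rightarrow> 'a) \<Rightarrow> bool" where
  "stationary_policy D \<phi> \<longleftrightarrow>
     \<phi> \<in> state_space D \<rightarrow>\<^sub>M action_space D \<and> (\<forall>x\<in>states D. \<phi> x \<in> avail D x)"

text \<open>
  The cost and the transition kernel are total functions here, but they are constrained, and
  matter, only on the graph of the action correspondence.
\<close>

locale borel_mdp =
  fixes D :: "('x::polish_space, 'a::polish_space, 'z) mdp_scheme"
  assumes states_borel: "states D \<in> sets borel"
    and actions_borel: "actions D \<in> sets borel"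
    and avail_nonempty: "\<And>x. x \<in> states D \<Longrightarrow> avail D x \<noteq> {}"
    and avail_borel: "\<And>x. x \<in> states D \<Longrightarrow> avail D x \<in> sets (action_space D)"
    and graph_borel: "graph D \<in> sets (step_space D)"
    and selector: "\<exists>\<phi>. stationary_policy D \<phi>"
    and cost_borel: "cost D \<in> borel_measurable (restrict_space (step_space D) (graph D))"
    and cost_bounded_below: "\<exists>K::real. \<forall>z\<in>graph D. ereal K \<le> cost D z"
    and kernel_borel:
      "kernel D \<in> restrict_space (step_space D) (graph D) \<rightarrow>\<^sub>M prob_algebra (state_space D)"


section \<open>Policies\<close>

text \<open>
  A history \<open>(\<xi>\<^sub>0, u\<^sub>0, \<dots>, u\<^bsub>n-1\<^esub>, \<xi>\<^sub>n)\<close> is the pair \<open>(\<omega>, \<xi>\<^sub>n)\<close> with \<open>\<omega> i = (\<xi>\<^sub>i, u\<^sub>i)\<close> for \<open>i < n\<close>.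
\<close>

type_synonym ('x, 'a) history = "(nat \<Rightarrow> 'x \<times> 'a) \<times> 'x"

type_synonym ('x, 'a) policy = "nat \<Rightarrow> ('x, 'a) history \<Rightarrow> 'a measure"

definition history_space ::
  "('x::topological_space, 'a::topological_space, 'z) mdp_scheme \<Rightarrow> nat \<Rightarrow> ('x, 'a) history measure" where
  "history_space D n = (\<Pi>\<^sub>M i\<in>{0..<n}. step_space D) \<Otimes>\<^sub>M state_space D"

definition policies ::
  "('x::topological_space, 'a::topological_space, 'z) mdp_scheme \<Rightarrow> ('x, 'a) policy set" where
  "policies D = {\<pi>. \<forall>n.
     \<pi> n \<in> history_space D n \<rightarrow>\<^sub>M prob_algebra (action_space D) \<and>
     (\<forall>(\<omega>, x)\<in>space (history_space D n). emeasure (\<pi> n (\<omega>, x)) (avail D x) = 1)}"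

definition stationary ::
  "('x, 'a::topological_space, 'z) mdp_scheme \<Rightarrow> ('x \<Rightarrow> 'a) \<Rightarrow> ('x, 'a) policy" where
  "stationary D \<phi> = (\<lambda>n (\<omega>, x). return (action_space D) (\<phi> x))"


lemma (in borel_mdp) stationary_in_policies:
  assumes "stationary_policy D \<phi>"
  shows "stationary D \<phi> \<in> policies D"
proof -
  have [measurable]: "\<phi> \<in> state_space D \<rightarrow>\<^sub>M action_space D"
    and \<phi>: "\<And>x. x \<in> states D \<Longrightarrow> \<phi> x \<in> avail D x"
    using assms by (auto simp: stationary_policy_def)
  have "stationary D \<phi> n \<in> history_space D n \<rightarrow>\<^sub>M prob_algebra (action_space D)" for n
    unfolding stationary_def history_space_def case_prod_beta by measurable
  moreover have "x \<in> states D" if "(\<omega>, x) \<in> space (history_space D n)" for n \<omega> x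
    using that by (simp add: history_space_def space_pair_measure state_space_def space_restrict_space)
  ultimately show ?thesis
    using \<phi> avail_borel by (fastforce simp: policies_def stationary_def)
qed


section \<open>The probability on trajectories\<close>

text \<open>
  The Ionescu-Tulcea construction needs a kernel on all of \<open>\<X> \<times> \<A>\<close>, so the kernel is extended off
  the graph by Dirac measures. The choice is irrelevant: under every policy, almost every trajectory
  stays in the graph.
\<close>

definition state_law ::
  "('x::topological_space, 'a, 'z) mdp_scheme \<Rightarrow> 'x \<Rightarrow> nat \<Rightarrow> (nat \<Rightarrow> 'x \<times> 'a) \<Rightarrow> 'x measure" where
  "state_law D x n \<omega> =
     (case n of
        0 \<Rightarrow> return (state_space D) x
      | Suc m \<Rightarrow> if \<omega> m \<in> graph D then kernel D (\<omega> m)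
                 else return (state_space D) (fst (\<omega> m)))"

definition step_law ::
  "('x::topological_space, 'a::topological_space, 'z) mdp_scheme \<Rightarrow> ('x, 'a) policy \<Rightarrow> 'x
     \<Rightarrow> nat \<Rightarrow> (nat \<Rightarrow> 'x \<times> 'a) \<Rightarrow> ('x \<times> 'a) measure" where
  "step_law D \<pi> x n \<omega> =
     state_law D x n \<omega> \<bind> (\<lambda>y. distr (\<pi> n (\<omega>, y)) (step_space D) (Pair y))"

definition trajectory_law ::
  "('x::topological_space, 'a::topological_space, 'z) mdp_scheme \<Rightarrow> ('x, 'a) policy \<Rightarrow> 'x
     \<Rightarrow> (nat \<Rightarrow> 'x \<times> 'a) measure" where
  "trajectory_law D \<pi> x =
     projective_family.lim UNIV
       (Ionescu_Tulcea.CI (step_law D \<pi> x) (\<lambda>_. step_space D)) (\<lambda>_. step_space D)"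

lemma (in borel_mdp) Ionescu_Tulcea_step_law:
  assumes "\<pi> \<in> policies D" "x \<in> states D"
  shows "Ionescu_Tulcea (step_law D \<pi> x) (\<lambda>_. step_space D)"
proof -
  have x: "x \<in> space (state_space D)"
    using assms by (simp add: state_space_def space_restrict_space)
  have \<pi>: "\<pi> n \<in> history_space D n \<rightarrow>\<^sub>M prob_algebra (action_space D)" for n
    using assms by (auto simp: policies_def)
  have ker[measurable]: "(\<lambda>z. if z \<in> graph D then kernel D z else return (state_space D) (fst z))
      \<in> step_space D \<rightarrow>\<^sub>M prob_algebra (state_space D)"
  proof (subst measurable_If_restrict_space_iff)
    show "{z \<in> space (step_space D). z \<in> graph D} \<in> sets (step_space D)"
      using graph_borel by measurable
    have "(\<lambda>z. return (state_space D) (fst z)) \<in> step_space D \<rightarrow>\<^sub>M prob_algebra (state_space D)"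
      unfolding step_space_def by measurable
    then show "kernel D \<in> restrict_space (step_space D) {z. z \<in> graph D} \<rightarrow>\<^sub>M prob_algebra (state_space D) \<and>
      (\<lambda>z. return (state_space D) (fst z))
        \<in> restrict_space (step_space D) {z. z \<notin> graph D} \<rightarrow>\<^sub>M prob_algebra (state_space D)"
      using kernel_borel by (auto intro: measurable_restrict_space1)
  qed
  have law: "state_law D x n \<in> PiM {0..<n} (\<lambda>_. step_space D) \<rightarrow>\<^sub>M prob_algebra (state_space D)" for n
  proof (cases n)
    case 0
    with x show ?thesis
      by (simp add: state_law_def[abs_def] measurable_const space_prob_algebra prob_space_return)
  next
    case (Suc m)
    then have [measurable]: "(\<lambda>\<omega>. \<omega> m) \<in> PiM {0..<n} (\<lambda>_. step_space D) \<rightarrow>\<^sub>M step_space D"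
      by (intro measurable_component_singleton) simp
    show ?thesis
      using measurable_compose[OF \<open>(\<lambda>\<omega>. \<omega> m) \<in> _\<close> ker] Suc by (simp add: state_law_def[abs_def])
  qed
  have step: "step_law D \<pi> x n \<in> PiM {0..<n} (\<lambda>_. step_space D) \<rightarrow>\<^sub>M prob_algebra (step_space D)" for n
  proof -
    note [measurable] = \<pi>[of n, unfolded history_space_def] law[of n]
    show ?thesis
      unfolding step_law_def[abs_def]
      apply (rule measurable_bind_prob_space2[OF law])
      apply (unfold case_prod_beta step_space_def)
      apply (rule measurable_distr_prob_space2[where M="action_space D"])
      using \<pi>[of n] apply (simp add: history_space_def step_space_def)
      apply measurable
      done
  qed
  show ?thesis
  proof (rule Ionescu_Tulcea.intro)
    show "step_law D \<pi> x i \<in> PiM {0..<i} (\<lambda>_. step_space D) \<rightarrow>\<^sub>M subprob_algebra (step_space D)" for i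
      by (rule measurable_prob_algebraD[OF step])
    show "prob_space (step_law D \<pi> x i \<omega>)" if "\<omega> \<in> space (PiM {0..<i} (\<lambda>_. step_space D))" for i \<omega>
      using measurable_space[OF step that] by (simp add: space_prob_algebra)
  qed
qed


section \<open>Costs and values\<close>

text \<open>
  Integral of an extended-real function: integral of the positive part minus integral of the
  negative part (\<^const>\<open>e2ennreal\<close> maps negative numbers to 0). All integrands
  below are bounded below almost surely, so the negative part has a finite integral.
\<close>

definition ereal_integral :: "'b measure \<Rightarrow> ('b \<Rightarrow> ereal) \<Rightarrow> ereal" where
  "ereal_integral M f =
     enn2ereal (\<integral>\<^sup>+\<omega>. e2ennreal (f \<omega>) \<partial>M) - enn2ereal (\<integral>\<^sup>+\<omega>. e2ennreal (- f \<omega>) \<partial>M)"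

definition total_cost ::
  "('x::topological_space, 'a::topological_space, 'z) mdp_scheme \<Rightarrow> ('x, 'a) policy \<Rightarrow> nat \<Rightarrow> 'x \<Rightarrow> ereal"
  where
  "total_cost D \<pi> N x = ereal_integral (trajectory_law D \<pi> x) (\<lambda>\<omega>. \<Sum>n<N. cost D (\<omega> n))"

definition disc_cost ::
  "('x::topological_space, 'a::topological_space, 'z) mdp_scheme \<Rightarrow> ('x, 'a) policy \<Rightarrow> real \<Rightarrow> 'x \<Rightarrow> ereal"
  where
  "disc_cost D \<pi> \<alpha> x =
     ereal_integral (trajectory_law D \<pi> x) (\<lambda>\<omega>. \<Sum>n. ereal (\<alpha> ^ n) * cost D (\<omega> n))"

definition avg_cost ::
  "('x::topological_space, 'a::topological_space, 'z) mdp_scheme \<Rightarrow> ('x, 'a) policy \<Rightarrow> 'x \<Rightarrow> ereal" where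
  "avg_cost D \<pi> x = limsup (\<lambda>N. ereal (1 / real N) * total_cost D \<pi> N x)"

definition disc_value ::
  "('x::topological_space, 'a::topological_space, 'z) mdp_scheme \<Rightarrow> real \<Rightarrow> 'x \<Rightarrow> ereal" where
  "disc_value D \<alpha> x = (INF \<pi>\<in>policies D. disc_cost D \<pi> \<alpha> x)"

definition avg_value ::
  "('x::topological_space, 'a::topological_space, 'z) mdp_scheme \<Rightarrow> 'x \<Rightarrow> ereal" where
  "avg_value D x = (INF \<pi>\<in>policies D. avg_cost D \<pi> x)"

definition avg_optimal ::
  "('x::topological_space, 'a::topological_space, 'z) mdp_scheme \<Rightarrow> ('x, 'a) policy \<Rightarrow> bool" where
  "avg_optimal D \<pi> \<longleftrightarrow> \<pi> \<in> policies D \<and> (\<forall>x\<in>states D. avg_cost D \<pi> x = avg_value D x)"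

definition disc_min ::
  "('x::topological_space, 'a::topological_space, 'z) mdp_scheme \<Rightarrow> real \<Rightarrow> ereal" where
  "disc_min D \<alpha> = (INF x\<in>states D. disc_value D \<alpha> x)"

definition w_upper ::
  "('x::topological_space, 'a::topological_space, 'z) mdp_scheme \<Rightarrow> ereal" where
  "w_upper D = Limsup (at_left 1) (\<lambda>\<alpha>. ereal (1 - \<alpha>) * disc_min D \<alpha>)"

definition w_star ::
  "('x::topological_space, 'a::topological_space, 'z) mdp_scheme \<Rightarrow> ereal" where
  "w_star D = (INF x\<in>states D. avg_value D x)"

end

theory Submission
  imports Defs
begin

text \<open>
  The equalities come from closing a cycle of inequalities. For every state \<open>x\<close>,
  \<open>w_upper D \<le> limsup (1 - \<alpha>) v\<^sub>\<alpha> x \<le> w x \<le> w\<^sup>\<phi> x \<le> w_upper D\<close>, where \<open>v\<^sub>\<alpha>\<close>, \<open>w\<close> and \<open>w\<^sup>\<phi>\<close> stand for the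
  discounted value, the average value and the average cost of \<open>\<phi>\<close>, and \<open>m\<^sub>\<alpha>\<close> for the infimum of \<open>v\<^sub>\<alpha>\<close>.
  The first inequality holds because \<open>m\<^sub>\<alpha> \<le> v\<^sub>\<alpha> x\<close>, the third because \<open>\<phi>\<close> is one of the policies.

  The second inequality (\<open>Limsup_disc_value_le_avg_value\<close>) is Abelian and holds policy by policy: if the
  mean cost over \<open>N\<close> steps is eventually below \<open>r\<close>, then the normalised discounted cost is at most
  \<open>r + (1 - \<alpha>) C\<close> for a constant \<open>C\<close>. This is Abel summation (\<open>discounted_sum_le\<close>).

  The last inequality (\<open>avg_cost_stationary_le\<close>) is where the optimality inequality enters. Integrated at
  the \<open>n\<close>-th step of the Markov chain driven by \<open>\<phi>\<close> it bounds the expected cost of that step by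
  \<open>w_upper D\<close> plus the decrease of the expectation of \<open>u\<close>; the decreases telescope to at most \<open>u x\<close>,
  which is negligible after division by \<open>N\<close>.

  Costs may be infinite and are only bounded below, so expectations are taken of the nonnegative function
  \<open>cost + L\<close>, for a large constant \<open>L\<close>, and \<open>L\<close> is subtracted afterwards (\<open>total_cost_eq\<close>,
  \<open>disc_cost_eq\<close>). The expected shifted costs \<open>mean_excess D \<pi> x L n\<close> then determine both kinds of
  cost of a policy.
\<close>

section \<open>Integrals along a trajectory\<close>

lemma (in Ionescu_Tulcea) up_to_atLeastLessThan: "up_to {0..<n} = n"
  using up_to[of "{0..<n}"] by (intro antisym) (auto simp: up_to_iff)

text \<open>
  The law of the first \<open>n\<close> coordinates is the \<open>n\<close>-fold composition of the kernels, so integrals over the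
  infinite product reduce to integrals over a finite one.
\<close>

lemma (in Ionescu_Tulcea) nn_integral_lim_prefix:
  assumes f: "f \<in> borel_measurable (PiM {0..<n} M)"
  shows "(\<integral>\<^sup>+\<omega>. f (restrict \<omega> {0..<n}) \<partial>PF.lim) = (\<integral>\<^sup>+\<omega>. f \<omega> \<partial>C 0 n (\<lambda>_. undefined))"
proof -
  have "distr PF.lim (PiM {0..<n} M) (\<lambda>\<omega>. restrict \<omega> {0..<n}) = C 0 n (\<lambda>_. undefined)"
    using distr_lim[of "{0..<n}"] distr_C[of n n "\<lambda>_. undefined" 0]
    by (simp add: CI_def up_to_atLeastLessThan)
  moreover have "(\<lambda>\<omega>. restrict \<omega> {0..<n}) \<in> PF.lim \<rightarrow>\<^sub>M PiM {0..<n} M"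
    by (auto intro!: measurable_restrict measurable_component_singleton
             simp: measurable_cong_sets[OF PF.sets_lim refl])
  ultimately show ?thesis
    using nn_integral_distr[of "\<lambda>\<omega>. restrict \<omega> {0..<n}" PF.lim "PiM {0..<n} M" f] f
    by (metis measurable_distr_eq1)
qed

text \<open>The coordinate \<open>n\<close> is drawn from \<open>P n\<close> once the coordinates before it are known.\<close>

lemma (in Ionescu_Tulcea) nn_integral_lim_coordinate:
  assumes h[measurable]: "h \<in> borel_measurable (M n)"
  shows "(\<integral>\<^sup>+\<omega>. h (\<omega> n) \<partial>PF.lim) = (\<integral>\<^sup>+\<omega>. \<integral>\<^sup>+z. h z \<partial>P n \<omega> \<partial>C 0 n (\<lambda>_. undefined))"
proof -
  have [measurable]: "(\<lambda>\<omega>. h (\<omega> n)) \<in> borel_measurable (PiM {0..<Suc n} M)"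
    by (rule measurable_compose[OF _ h]) (simp add: measurable_component_singleton)
  have "sets (C 0 n (\<lambda>_. undefined)) = sets (PiM {0..<n} M)"
    using sets_C[of "\<lambda>_. undefined" 0 n] by simp
  then have eP: "eP n \<in> C 0 n (\<lambda>_. undefined) \<rightarrow>\<^sub>M subprob_algebra (PiM {0..<Suc n} M)"
    using measurable_eP measurable_cong_sets by blast
  have "(\<integral>\<^sup>+\<omega>. h (\<omega> n) \<partial>PF.lim) = (\<integral>\<^sup>+\<omega>. h (\<omega> n) \<partial>C 0 (Suc n) (\<lambda>_. undefined))"
    using nn_integral_lim_prefix[of "\<lambda>\<omega>. h (\<omega> n)" "Suc n"] by simp
  also have "\<dots> = (\<integral>\<^sup>+\<omega>. \<integral>\<^sup>+\<omega>'. h (\<omega>' n) \<partial>eP n \<omega> \<partial>C 0 n (\<lambda>_. undefined))"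
    using nn_integral_bind[OF \<open>(\<lambda>\<omega>. h (\<omega> n)) \<in> _\<close> eP] by simp
  also have "\<dots> = (\<integral>\<^sup>+\<omega>. \<integral>\<^sup>+z. h z \<partial>P n \<omega> \<partial>C 0 n (\<lambda>_. undefined))"
    by (intro nn_integral_cong) (simp add: space_C nn_integral_eP)
  finally show ?thesis .
qed

text \<open>
  The extension by Dirac measures that is built into \<^const>\<open>state_law\<close>. As a function on the whole of
  \<^const>\<open>step_space\<close> it can be composed with coordinates of a trajectory before these are known to lie
  in the graph.
\<close>

definition ext_kernel :: "('x::topological_space, 'a, 'z) mdp_scheme \<Rightarrow> 'x \<times> 'a \<Rightarrow> 'x measure" where
  "ext_kernel D z = (if z \<in> graph D then kernel D z else return (state_space D) (fst z))"

lemma state_law_0: "state_law D x 0 \<omega> = return (state_space D) x"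
  by (simp add: state_law_def)

lemma state_law_Suc: "state_law D x (Suc m) \<omega> = ext_kernel D (\<omega> m)"
  by (simp add: state_law_def ext_kernel_def)

context borel_mdp
begin

lemma space_state_space: "space (state_space D) = states D"
  by (simp add: state_space_def space_restrict_space)

lemma measurable_ext_kernel:
  "ext_kernel D \<in> step_space D \<rightarrow>\<^sub>M prob_algebra (state_space D)"
proof -
  have G: "{z \<in> space (step_space D). z \<in> graph D} \<in> sets (step_space D)"
    using graph_borel by measurable
  have "(\<lambda>z. return (state_space D) (fst z)) \<in> step_space D \<rightarrow>\<^sub>M prob_algebra (state_space D)"
    unfolding step_space_def by measurable
  then show ?thesis
    unfolding ext_kernel_def[abs_def] using kernel_borel
    by (auto simp: measurable_If_restrict_space_iff[OF G] intro: measurable_restrict_space1)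
qed

lemma space_ext_kernel: "z \<in> space (step_space D) \<Longrightarrow> space (ext_kernel D z) = states D"
  using measurable_space[OF measurable_ext_kernel, of z] sets_eq_imp_space_eq[of "ext_kernel D z"]
  by (simp add: space_prob_algebra space_state_space)

lemma measurable_state_law:
  assumes "x \<in> states D"
  shows "state_law D x n \<in> PiM {0..<n} (\<lambda>_. step_space D) \<rightarrow>\<^sub>M prob_algebra (state_space D)"
proof (cases n)
  case 0
  then show ?thesis
    using assms
    by (simp add: state_law_0[abs_def] space_state_space space_prob_algebra prob_space_return
          measurable_const)
next
  case (Suc m)
  then show ?thesis
    by (auto simp: state_law_Suc[abs_def]
        intro!: measurable_compose[OF _ measurable_ext_kernel] measurable_component_singleton)
qed

lemma sets_state_law:
  assumes "x \<in> states D" "\<omega> \<in> space (PiM {0..<n} (\<lambda>_. step_space D))"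
  shows "sets (state_law D x n \<omega>) = sets (state_space D)"
  using measurable_space[OF measurable_state_law[OF assms(1)] assms(2)]
  by (simp add: space_prob_algebra)

lemma space_state_law:
  assumes "x \<in> states D" "\<omega> \<in> space (PiM {0..<n} (\<lambda>_. step_space D))"
  shows "space (state_law D x n \<omega>) = states D"
  using sets_eq_imp_space_eq[OF sets_state_law[OF assms]] by (simp add: space_state_space)

lemma nn_integral_step_law:
  assumes \<pi>: "\<pi> \<in> policies D" and x: "x \<in> states D"
    and \<omega>: "\<omega> \<in> space (PiM {0..<n} (\<lambda>_. step_space D))"
    and h[measurable]: "h \<in> borel_measurable (step_space D)"
  shows "(\<integral>\<^sup>+z. h z \<partial>step_law D \<pi> x n \<omega>)
    = (\<integral>\<^sup>+y. \<integral>\<^sup>+a. h (y, a) \<partial>\<pi> n (\<omega>, y) \<partial>state_law D x n \<omega>)"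
proof -
  have "\<pi> n \<in> history_space D n \<rightarrow>\<^sub>M prob_algebra (action_space D)"
    using \<pi> by (auto simp: policies_def)
  then have p: "(\<lambda>y. \<pi> n (\<omega>, y)) \<in> state_space D \<rightarrow>\<^sub>M prob_algebra (action_space D)"
    unfolding history_space_def using measurable_Pair1'[OF \<omega>]
    by (rule measurable_compose[rotated])
  note sets_law = sets_state_law[OF x \<omega>]
  have "(\<lambda>y. distr (\<pi> n (\<omega>, y)) (step_space D) (Pair y))
      \<in> state_space D \<rightarrow>\<^sub>M prob_algebra (step_space D)"
    by (rule measurable_distr_prob_space2[OF p]) (simp add: step_space_def)
  then have k: "(\<lambda>y. distr (\<pi> n (\<omega>, y)) (step_space D) (Pair y))
      \<in> state_law D x n \<omega> \<rightarrow>\<^sub>M subprob_algebra (step_space D)"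
    by (simp add: measurable_cong_sets[OF sets_law refl] measurable_prob_algebraD)
  have "(\<integral>\<^sup>+z. h z \<partial>distr (\<pi> n (\<omega>, y)) (step_space D) (Pair y)) = (\<integral>\<^sup>+a. h (y, a) \<partial>\<pi> n (\<omega>, y))"
    if "y \<in> space (state_law D x n \<omega>)" for y
  proof (rule nn_integral_distr)
    have y: "y \<in> space (state_space D)"
      using that sets_eq_imp_space_eq[OF sets_law] by simp
    have "sets (\<pi> n (\<omega>, y)) = sets (action_space D)"
      using measurable_space[OF p y] by (simp add: space_prob_algebra)
    then show "Pair y \<in> \<pi> n (\<omega>, y) \<rightarrow>\<^sub>M step_space D"
      using measurable_Pair1'[OF y] measurable_cong_sets unfolding step_space_def by blast
  qed simp
  then show ?thesis
    unfolding step_law_def nn_integral_bind[OF h k] by (rule nn_integral_cong)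
qed

lemma prob_space_trajectory_law:
  assumes "\<pi> \<in> policies D" "x \<in> states D"
  shows "prob_space (trajectory_law D \<pi> x)"
proof -
  interpret IT: Ionescu_Tulcea "step_law D \<pi> x" "\<lambda>_. step_space D"
    using assms by (rule Ionescu_Tulcea_step_law)
  have "emeasure IT.PF.lim (space IT.PF.lim) = 1"
    using IT.nn_integral_lim_prefix[of "\<lambda>_. 1" 0]
    by (simp add: prob_space.emeasure_space_1[OF IT.prob_space_C[of _ 0 0, simplified]])
  then show ?thesis
    unfolding trajectory_law_def by (rule prob_spaceI)
qed

lemma measurable_coordinate:
  assumes "\<pi> \<in> policies D" "x \<in> states D"
  shows "(\<lambda>\<omega>. \<omega> n) \<in> trajectory_law D \<pi> x \<rightarrow>\<^sub>M step_space D"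
proof -
  interpret IT: Ionescu_Tulcea "step_law D \<pi> x" "\<lambda>_. step_space D"
    using assms by (rule Ionescu_Tulcea_step_law)
  show ?thesis
    unfolding trajectory_law_def measurable_cong_sets[OF IT.PF.sets_lim refl]
    by (rule measurable_component_singleton) simp
qed

text \<open>
  At each time the policy puts mass 1 on the available actions, whatever the history. Hence the values of
  the cost off the graph, where it need not even be measurable, do not affect any expectation.
\<close>

lemma AE_trajectory_in_graph:
  assumes \<pi>: "\<pi> \<in> policies D" and x: "x \<in> states D"
  shows "AE \<omega> in trajectory_law D \<pi> x. \<forall>n. \<omega> n \<in> graph D"
proof -
  interpret IT: Ionescu_Tulcea "step_law D \<pi> x" "\<lambda>_. step_space D"
    using assms by (rule Ionescu_Tulcea_step_law)
  define h :: "'x \<times> 'a \<Rightarrow> ennreal" where "h = indicator (- graph D)"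
  have h[measurable]: "h \<in> borel_measurable (step_space D)"
    unfolding h_def using graph_borel by (intro borel_measurable_indicator') auto
  have "AE \<omega> in trajectory_law D \<pi> x. \<omega> n \<in> graph D" for n
  proof -
    have "(\<integral>\<^sup>+z. h z \<partial>step_law D \<pi> x n \<omega>) = 0"
      if \<omega>: "\<omega> \<in> space (PiM {0..<n} (\<lambda>_. step_space D))" for \<omega>
    proof -
      have "(\<integral>\<^sup>+a. h (y, a) \<partial>\<pi> n (\<omega>, y)) = 0" if "y \<in> space (state_law D x n \<omega>)" for y
      proof -
        have y: "y \<in> states D"
          using that by (simp add: space_state_law[OF x \<omega>])
        then have hist: "(\<omega>, y) \<in> space (history_space D n)"
          using \<omega> by (simp add: history_space_def space_pair_measure space_state_space)
        have "\<pi> n \<in> history_space D n \<rightarrow>\<^sub>M prob_algebra (action_space D)"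
          and one: "emeasure (\<pi> n (\<omega>, y)) (avail D y) = 1"
          using \<pi> hist by (auto simp: policies_def)
        then have "\<pi> n (\<omega>, y) \<in> space (prob_algebra (action_space D))"
          using hist by (auto intro: measurable_space)
        then interpret prob_space "\<pi> n (\<omega>, y)"
          by (simp add: space_prob_algebra)
        have "AE a in \<pi> n (\<omega>, y). a \<in> avail D y"
          using one by (intro AE_prob_1) (simp add: measure_def)
        then have "AE a in \<pi> n (\<omega>, y). h (y, a) = 0"
          by eventually_elim (simp add: h_def graph_def y)
        then show ?thesis
          using nn_integral_cong_AE by fastforce
      qed
      then show ?thesis
        using nn_integral_step_law[OF \<pi> x \<omega> h] by (simp cong: nn_integral_cong)
    qed
    then have "(\<integral>\<^sup>+\<omega>. h (\<omega> n) \<partial>trajectory_law D \<pi> x) = 0"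
      unfolding trajectory_law_def IT.nn_integral_lim_coordinate[OF h]
      by (subst nn_integral_cong[where v="\<lambda>_. 0"]) (simp_all add: IT.space_C)
    moreover have "(\<lambda>\<omega>. h (\<omega> n)) \<in> borel_measurable (trajectory_law D \<pi> x)"
      using measurable_compose[OF measurable_coordinate[OF \<pi> x] h] .
    ultimately have "AE \<omega> in trajectory_law D \<pi> x. h (\<omega> n) = 0"
      by (simp add: nn_integral_0_iff_AE)
    then show ?thesis
      by eventually_elim (simp add: h_def indicator_def split: if_splits)
  qed
  then show ?thesis
    by (simp add: AE_all_countable)
qed

end

section \<open>The Markov property of a stationary policy\<close>

context borel_mdp
begin

lemma measurable_stationary_step:
  assumes "stationary_policy D \<phi>" "h \<in> borel_measurable (step_space D)"
  shows "(\<lambda>y. h (y, \<phi> y)) \<in> borel_measurable (state_space D)"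
proof -
  have "(\<lambda>y. (y, \<phi> y)) \<in> state_space D \<rightarrow>\<^sub>M step_space D"
    using assms(1) unfolding stationary_policy_def step_space_def
    by (intro measurable_Pair) auto
  then show ?thesis
    using assms(2) by (rule measurable_compose)
qed

lemma nn_integral_stationary_step_law:
  assumes \<phi>: "stationary_policy D \<phi>" and x: "x \<in> states D"
    and \<omega>: "\<omega> \<in> space (PiM {0..<n} (\<lambda>_. step_space D))"
    and h: "h \<in> borel_measurable (step_space D)"
  shows "(\<integral>\<^sup>+z. h z \<partial>step_law D (stationary D \<phi>) x n \<omega>)
    = (\<integral>\<^sup>+y. h (y, \<phi> y) \<partial>state_law D x n \<omega>)"
  unfolding nn_integral_step_law[OF stationary_in_policies[OF \<phi>] x \<omega> h]
proof (rule nn_integral_cong)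
  fix y assume "y \<in> space (state_law D x n \<omega>)"
  then have y: "y \<in> space (state_space D)"
    by (simp add: space_state_law[OF x \<omega>] space_state_space)
  have "(\<lambda>a. h (y, a)) \<in> borel_measurable (action_space D)"
    using measurable_compose[OF measurable_Pair1'[OF y] h[unfolded step_space_def]] .
  moreover have "\<phi> y \<in> space (action_space D)"
    using \<phi> y unfolding stationary_policy_def by (auto dest: measurable_space)
  ultimately show "(\<integral>\<^sup>+a. h (y, a) \<partial>stationary D \<phi> n (\<omega>, y)) = h (y, \<phi> y)"
    by (simp add: stationary_def nn_integral_return)
qed

lemma nn_integral_stationary_0:
  assumes \<phi>: "stationary_policy D \<phi>" and x: "x \<in> states D"
    and h: "h \<in> borel_measurable (step_space D)"
  shows "(\<integral>\<^sup>+\<omega>. h (\<omega> 0) \<partial>trajectory_law D (stationary D \<phi>) x) = h (x, \<phi> x)"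
proof -
  interpret IT: Ionescu_Tulcea "step_law D (stationary D \<phi>) x" "\<lambda>_. step_space D"
    using stationary_in_policies[OF \<phi>] x by (rule Ionescu_Tulcea_step_law)
  have "(\<integral>\<^sup>+z. h z \<partial>step_law D (stationary D \<phi>) x 0 \<omega>) = h (x, \<phi> x)"
    if "\<omega> \<in> space (PiM {0..<0} (\<lambda>_. step_space D))" for \<omega>
    unfolding nn_integral_stationary_step_law[OF \<phi> x that h] state_law_0
    using x measurable_stationary_step[OF \<phi> h]
    by (simp add: nn_integral_return space_state_space)
  then show ?thesis
    unfolding trajectory_law_def IT.nn_integral_lim_coordinate[OF h]
    using prob_space.emeasure_space_1[OF IT.prob_space_C[of "\<lambda>_. undefined" 0 0]]
    by (subst nn_integral_cong[where v="\<lambda>_. h (x, \<phi> x)"]) (simp_all add: IT.space_C del: IT.C.simps)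
qed

text \<open>
  The Markov property. The conditional law of the next state depends on the past through the last step
  only, so the integrand moves back one time unit at the price of integrating it against the kernel.
\<close>

lemma nn_integral_stationary_Suc:
  assumes \<phi>: "stationary_policy D \<phi>" and x: "x \<in> states D"
    and h: "h \<in> borel_measurable (step_space D)"
  shows "(\<integral>\<^sup>+\<omega>. h (\<omega> (Suc n)) \<partial>trajectory_law D (stationary D \<phi>) x)
    = (\<integral>\<^sup>+\<omega>. \<integral>\<^sup>+y. h (y, \<phi> y) \<partial>ext_kernel D (\<omega> n) \<partial>trajectory_law D (stationary D \<phi>) x)"
proof -
  interpret IT: Ionescu_Tulcea "step_law D (stationary D \<phi>) x" "\<lambda>_. step_space D"
    using stationary_in_policies[OF \<phi>] x by (rule Ionescu_Tulcea_step_law)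
  let ?H = "\<lambda>z. \<integral>\<^sup>+y. h (y, \<phi> y) \<partial>ext_kernel D z"
  have H: "?H \<in> borel_measurable (step_space D)"
    using measurable_prob_algebraD[OF measurable_ext_kernel] measurable_stationary_step[OF \<phi> h]
    by (rule measurable_compose[OF _ nn_integral_measurable_subprob_algebra])
  have "(\<integral>\<^sup>+\<omega>. h (\<omega> (Suc n)) \<partial>IT.PF.lim) = (\<integral>\<^sup>+\<omega>. ?H (\<omega> n) \<partial>IT.C 0 (Suc n) (\<lambda>_. undefined))"
    unfolding IT.nn_integral_lim_coordinate[OF h]
    by (intro nn_integral_cong)
       (simp add: IT.space_C nn_integral_stationary_step_law[OF \<phi> x _ h] state_law_Suc del: IT.C.simps)
  also have "\<dots> = (\<integral>\<^sup>+\<omega>. ?H (\<omega> n) \<partial>IT.PF.lim)"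
    using IT.nn_integral_lim_prefix[of "\<lambda>\<omega>. ?H (\<omega> n)" "Suc n"]
      measurable_compose[OF measurable_component_singleton[of n "{0..<Suc n}" "\<lambda>_. step_space D"] H]
    by simp
  finally show ?thesis
    unfolding trajectory_law_def .
qed

text \<open>
  Under a stationary policy only the values of an integrand on the graph of \<open>\<phi>\<close> matter. This is
  what allows an inequality known only at the pairs \<open>(x, \<phi> x)\<close> to be integrated.
\<close>

lemma nn_integral_stationary_mono:
  assumes \<phi>: "stationary_policy D \<phi>" and x: "x \<in> states D"
    and h: "h \<in> borel_measurable (step_space D)" and k: "k \<in> borel_measurable (step_space D)"
    and le: "\<And>y. y \<in> states D \<Longrightarrow> h (y, \<phi> y) \<le> k (y, \<phi> y)"
  shows "(\<integral>\<^sup>+\<omega>. h (\<omega> n) \<partial>trajectory_law D (stationary D \<phi>) x)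
    \<le> (\<integral>\<^sup>+\<omega>. k (\<omega> n) \<partial>trajectory_law D (stationary D \<phi>) x)"
proof (cases n)
  case 0
  then show ?thesis
    using le[OF x] by (simp add: nn_integral_stationary_0[OF \<phi> x] h k)
next
  case (Suc m)
  have le': "(\<integral>\<^sup>+y. h (y, \<phi> y) \<partial>ext_kernel D z) \<le> (\<integral>\<^sup>+y. k (y, \<phi> y) \<partial>ext_kernel D z)"
    if "z \<in> space (step_space D)" for z
    by (intro nn_integral_mono le) (simp add: space_ext_kernel[OF that])
  show ?thesis
    unfolding Suc nn_integral_stationary_Suc[OF \<phi> x h] nn_integral_stationary_Suc[OF \<phi> x k]
    using measurable_space[OF measurable_coordinate[OF stationary_in_policies[OF \<phi>] x]]
    by (rule nn_integral_mono[OF le'])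
qed

end

section \<open>Costs as integrals of nonnegative functions\<close>

text \<open>
  Positive and negative part satisfy \<open>(g - k)\<^sup>+ + k = g + (g - k)\<^sup>-\<close>. This may be integrated term by term,
  and the integral of the negative part is at most \<open>k\<close>, so it may be subtracted even if that of \<open>g\<close> is infinite.
\<close>

lemma ereal_integral_shift:
  assumes M: "prob_space M" and g[measurable]: "g \<in> borel_measurable M" and k: "0 \<le> k"
    and f: "AE \<omega> in M. f \<omega> = enn2ereal (g \<omega>) - ereal k"
  shows "ereal_integral M f = enn2ereal (\<integral>\<^sup>+\<omega>. g \<omega> \<partial>M) - ereal k"
proof -
  interpret prob_space M by (rule M)
  have pos: "e2ennreal (enn2ereal a - ereal k) = a - ennreal k" for a
    using e2eenreal_enn2ereal_diff[of a "ennreal k"] k by simp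
  have neg: "e2ennreal (- (enn2ereal a - ereal k)) = ennreal k - a" for a
    using k by (cases a) (simp_all add: ennreal_minus e2ennreal_neg)
  have bal: "(a - ennreal k) + ennreal k = a + (ennreal k - a)" for a
    by (auto simp: diff_add_self_ennreal add_diff_self_ennreal)
  have "(\<integral>\<^sup>+\<omega>. e2ennreal (f \<omega>) \<partial>M) = (\<integral>\<^sup>+\<omega>. g \<omega> - ennreal k \<partial>M)"
    using f by (intro nn_integral_cong_AE) (auto simp: pos)
  moreover have "(\<integral>\<^sup>+\<omega>. e2ennreal (- f \<omega>) \<partial>M) = (\<integral>\<^sup>+\<omega>. ennreal k - g \<omega> \<partial>M)"
    using f by (intro nn_integral_cong_AE) (auto simp: neg)
  moreover have "(\<integral>\<^sup>+\<omega>. g \<omega> - ennreal k \<partial>M) + ennreal k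
      = (\<integral>\<^sup>+\<omega>. g \<omega> \<partial>M) + (\<integral>\<^sup>+\<omega>. ennreal k - g \<omega> \<partial>M)"
  proof -
    have "(\<integral>\<^sup>+\<omega>. g \<omega> - ennreal k \<partial>M) + ennreal k = (\<integral>\<^sup>+\<omega>. (g \<omega> - ennreal k) + ennreal k \<partial>M)"
      by (simp add: nn_integral_add emeasure_space_1)
    then show ?thesis
      by (simp add: bal nn_integral_add)
  qed
  moreover have "(\<integral>\<^sup>+\<omega>. ennreal k - g \<omega> \<partial>M) < \<infinity>"
  proof -
    have "(\<integral>\<^sup>+\<omega>. ennreal k - g \<omega> \<partial>M) \<le> (\<integral>\<^sup>+\<omega>. ennreal k \<partial>M)"
      by (intro nn_integral_mono) (simp add: diff_le_self_ennreal)
    then show ?thesis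
      by (simp add: emeasure_space_1 le_less_trans[OF _ ennreal_less_top])
  qed
  ultimately show ?thesis
    unfolding ereal_integral_def using k
    by (cases "\<integral>\<^sup>+\<omega>. g \<omega> - ennreal k \<partial>M"; cases "\<integral>\<^sup>+\<omega>. g \<omega> \<partial>M"; cases "\<integral>\<^sup>+\<omega>. ennreal k - g \<omega> \<partial>M")
       (simp_all add: ennreal_plus[symmetric] del: ennreal_plus)
qed

lemma sum_weighted_shift:
  fixes w :: "nat \<Rightarrow> real"
  assumes w: "\<And>n. 0 \<le> w n"
  shows "(\<Sum>n<N. ereal (w n) * (enn2ereal (g n) - ereal L))
    = enn2ereal (\<Sum>n<N. ennreal (w n) * g n) - ereal (L * (\<Sum>n<N. w n))"
proof (induction N)
  case 0
  then show ?case by (simp add: zero_ennreal.rep_eq)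
next
  case (Suc N)
  have "ereal (w N) * (enn2ereal (g N) - ereal L) = enn2ereal (ennreal (w N) * g N) - ereal (L * w N)"
    using w[of N]
    by (cases "g N"; cases "w N = 0")
       (auto simp: times_ennreal.rep_eq zero_ennreal.rep_eq algebra_simps top_ennreal.rep_eq)
  moreover have "(enn2ereal a - ereal s) + (enn2ereal b - ereal t) = enn2ereal (a + b) - ereal (s + t)"
    for a b s t
    unfolding plus_ennreal.rep_eq by (cases a; cases b) auto
  ultimately show ?case
    by (simp add: Suc.IH distrib_left)
qed

lemma suminf_discounted_shift:
  fixes \<alpha> :: real
  assumes \<alpha>: "0 < \<alpha>" "\<alpha> < 1"
  shows "(\<Sum>n. ereal (\<alpha> ^ n) * (enn2ereal (g n) - ereal L))
    = enn2ereal (\<Sum>n. ennreal (\<alpha> ^ n) * g n) - ereal (L / (1 - \<alpha>))"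
proof -
  have "(\<lambda>N. enn2ereal (\<Sum>n<N. ennreal (\<alpha> ^ n) * g n)) \<longlonglongrightarrow> enn2ereal (\<Sum>n. ennreal (\<alpha> ^ n) * g n)"
    by (intro tendsto_enn2erealI summable_LIMSEQ summableI)
  moreover have "(\<lambda>N. ereal (L * (\<Sum>n<N. \<alpha> ^ n))) \<longlonglongrightarrow> ereal (L / (1 - \<alpha>))"
    using tendsto_mult_left[OF geometric_sums[of \<alpha>, unfolded sums_def], of L] \<alpha> by simp
  ultimately have "(\<lambda>N. enn2ereal (\<Sum>n<N. ennreal (\<alpha> ^ n) * g n) - ereal (L * (\<Sum>n<N. \<alpha> ^ n)))
      \<longlonglongrightarrow> enn2ereal (\<Sum>n. ennreal (\<alpha> ^ n) * g n) - ereal (L / (1 - \<alpha>))"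
    by (intro tendsto_diff_ereal_general) auto
  then have "(\<lambda>n. ereal (\<alpha> ^ n) * (enn2ereal (g n) - ereal L))
      sums (enn2ereal (\<Sum>n. ennreal (\<alpha> ^ n) * g n) - ereal (L / (1 - \<alpha>)))"
    using \<alpha> by (simp add: sums_def sum_weighted_shift)
  then show ?thesis
    by (rule sums_unique[symmetric])
qed

text \<open>
  Shifting by \<open>L\<close> turns expected costs into Lebesgue integrals of nonnegative functions, which always
  exist and commute with infinite sums. The value 0 off the graph makes the function measurable there.
\<close>

definition excess :: "('x, 'a, 'z) mdp_scheme \<Rightarrow> real \<Rightarrow> 'x \<times> 'a \<Rightarrow> ennreal" where
  "excess D L z = (if z \<in> graph D then e2ennreal (cost D z + ereal L) else 0)"

lemma cost_eq_excess:
  assumes "z \<in> graph D" "ereal (- L) \<le> cost D z"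
  shows "cost D z = enn2ereal (excess D L z) - ereal L"
proof -
  have "0 \<le> cost D z + ereal L"
    using assms(2) by (cases "cost D z") auto
  then show ?thesis
    using assms by (cases "cost D z") (simp_all add: excess_def enn2ereal_e2ennreal)
qed

definition mean_excess ::
  "('x::topological_space, 'a::topological_space, 'z) mdp_scheme \<Rightarrow> ('x, 'a) policy \<Rightarrow> 'x \<Rightarrow> real \<Rightarrow> nat
     \<Rightarrow> ennreal" where
  "mean_excess D \<pi> x L n = (\<integral>\<^sup>+\<omega>. excess D L (\<omega> n) \<partial>trajectory_law D \<pi> x)"

context borel_mdp
begin

lemma measurable_excess: "excess D L \<in> borel_measurable (step_space D)"
proof -
  have G: "{z \<in> space (step_space D). z \<in> graph D} \<in> sets (step_space D)"
    using graph_borel by measurable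
  have "(\<lambda>z. e2ennreal (cost D z + ereal L)) \<in> borel_measurable (restrict_space (step_space D) (graph D))"
    using cost_borel by measurable
  then show ?thesis
    unfolding excess_def[abs_def] by (simp add: measurable_If_restrict_space_iff[OF G])
qed

text \<open>
  The free choice of \<open>r\<close> later serves to make the shifted optimal value \<open>w + L\<close> nonnegative as well.
\<close>

lemma cost_lower_bound:
  obtains L where "0 \<le> L" "r \<le> L" "\<And>z. z \<in> graph D \<Longrightarrow> ereal (- L) \<le> cost D z"
proof -
  obtain K where K: "\<And>z. z \<in> graph D \<Longrightarrow> ereal K \<le> cost D z"
    using cost_bounded_below by auto
  show ?thesis
  proof (rule that[of "max 0 (max r (- K))"])
    fix z assume "z \<in> graph D"
    then have "ereal K \<le> cost D z" by (rule K)
    moreover have "ereal (- max 0 (max r (- K))) \<le> ereal K" by simp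
    ultimately show "ereal (- max 0 (max r (- K))) \<le> cost D z"
      by (rule order_trans[rotated])
  qed auto
qed

lemma total_cost_eq:
  assumes \<pi>: "\<pi> \<in> policies D" and x: "x \<in> states D"
    and L: "0 \<le> L" "\<And>z. z \<in> graph D \<Longrightarrow> ereal (- L) \<le> cost D z"
  shows "total_cost D \<pi> N x = enn2ereal (\<Sum>n<N. mean_excess D \<pi> x L n) - ereal (L * real N)"
proof -
  have m[measurable]: "(\<lambda>\<omega>. excess D L (\<omega> n)) \<in> borel_measurable (trajectory_law D \<pi> x)" for n
    using measurable_compose[OF measurable_coordinate[OF \<pi> x] measurable_excess] .
  have "AE \<omega> in trajectory_law D \<pi> x.
      (\<Sum>n<N. cost D (\<omega> n)) = enn2ereal (\<Sum>n<N. excess D L (\<omega> n)) - ereal (L * real N)"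
    using AE_trajectory_in_graph[OF \<pi> x]
  proof eventually_elim
    case (elim \<omega>)
    then have "(\<Sum>n<N. cost D (\<omega> n)) = (\<Sum>n<N. enn2ereal (excess D L (\<omega> n)) - ereal L)"
      by (intro sum.cong refl cost_eq_excess L) auto
    then show ?case
      using sum_weighted_shift[of "\<lambda>_. 1" "\<lambda>n. excess D L (\<omega> n)" L N]
      by (simp flip: one_ereal_def)
  qed
  then have "total_cost D \<pi> N x
      = enn2ereal (\<integral>\<^sup>+\<omega>. (\<Sum>n<N. excess D L (\<omega> n)) \<partial>trajectory_law D \<pi> x) - ereal (L * real N)"
    unfolding total_cost_def using L
    by (intro ereal_integral_shift prob_space_trajectory_law \<pi> x) auto
  then show ?thesis
    by (simp add: nn_integral_sum mean_excess_def)
qed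

lemma disc_cost_eq:
  assumes \<pi>: "\<pi> \<in> policies D" and x: "x \<in> states D" and \<alpha>: "0 < \<alpha>" "\<alpha> < 1"
    and L: "0 \<le> L" "\<And>z. z \<in> graph D \<Longrightarrow> ereal (- L) \<le> cost D z"
  shows "disc_cost D \<pi> \<alpha> x
    = enn2ereal (\<Sum>n. ennreal (\<alpha> ^ n) * mean_excess D \<pi> x L n) - ereal (L / (1 - \<alpha>))"
proof -
  have m[measurable]: "(\<lambda>\<omega>. excess D L (\<omega> n)) \<in> borel_measurable (trajectory_law D \<pi> x)" for n
    using measurable_compose[OF measurable_coordinate[OF \<pi> x] measurable_excess] .
  have "AE \<omega> in trajectory_law D \<pi> x. (\<Sum>n. ereal (\<alpha> ^ n) * cost D (\<omega> n))
      = enn2ereal (\<Sum>n. ennreal (\<alpha> ^ n) * excess D L (\<omega> n)) - ereal (L / (1 - \<alpha>))"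
    using AE_trajectory_in_graph[OF \<pi> x]
  proof eventually_elim
    case (elim \<omega>)
    then have "cost D (\<omega> n) = enn2ereal (excess D L (\<omega> n)) - ereal L" for n
      by (intro cost_eq_excess L) auto
    then show ?case
      by (simp only: suminf_discounted_shift[OF \<alpha>])
  qed
  then have "disc_cost D \<pi> \<alpha> x
      = enn2ereal (\<integral>\<^sup>+\<omega>. (\<Sum>n. ennreal (\<alpha> ^ n) * excess D L (\<omega> n)) \<partial>trajectory_law D \<pi> x)
        - ereal (L / (1 - \<alpha>))"
    unfolding disc_cost_def using L \<alpha>
    by (intro ereal_integral_shift prob_space_trajectory_law \<pi> x) auto
  then show ?thesis
    by (simp add: nn_integral_suminf nn_integral_cmult mean_excess_def)
qed

end

section \<open>Discounted and average costs of one policy\<close>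

text \<open>
  Abel summation: the weights \<open>\<alpha> ^ n\<close> start at 1 and decrease, so the weighted sum is a convex
  combination of partial sums, with weight \<open>(1 - \<alpha>) \<alpha> ^ n\<close> on the sum of the first \<open>n + 1\<close> terms
  and weight \<open>\<alpha> ^ N\<close> on the sum of all \<open>N\<close> terms.
\<close>

lemma discounted_sum_le:
  fixes a :: "nat \<Rightarrow> real"
  assumes a: "\<And>N. (\<Sum>n<N. a n) \<le> C" and \<alpha>: "0 \<le> \<alpha>" "\<alpha> \<le> 1"
  shows "(\<Sum>n<N. \<alpha> ^ n * a n) \<le> C"
proof -
  have abel: "(\<Sum>n<N. \<alpha> ^ n * a n)
      = \<alpha> ^ N * (\<Sum>n<N. a n) + (1 - \<alpha>) * (\<Sum>n<N. \<alpha> ^ n * (\<Sum>k<Suc n. a k))"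
    by (induction N) (simp_all add: algebra_simps)
  have "(\<Sum>n<N. \<alpha> ^ n * a n) \<le> \<alpha> ^ N * C + (1 - \<alpha>) * (\<Sum>n<N. \<alpha> ^ n * C)"
    unfolding abel using \<alpha> a by (intro add_mono mult_left_mono sum_mono) (auto simp del: sum.lessThan_Suc)
  also have "(1 - \<alpha>) * (\<Sum>n<N. \<alpha> ^ n * C) = (1 - \<alpha> ^ N) * C"
    by (simp only: one_diff_power_eq sum_distrib_right[symmetric] mult.assoc[symmetric])
  also have "\<alpha> ^ N * C + (1 - \<alpha> ^ N) * C = C"
    by (simp add: algebra_simps)
  finally show ?thesis .
qed

context borel_mdp
begin

text \<open>
  The Abelian half of the Tauberian theorem. If \<open>v\<^sub>N \<le> r N\<close> for large \<open>N\<close>, then \<open>v\<^sub>N \<le> C + r N\<close> for all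
  \<open>N\<close>, and Abel summation turns this into the bound \<open>C + r / (1 - \<alpha>)\<close> of the discounted cost.
\<close>

lemma Limsup_disc_cost_le_avg_cost:
  assumes \<pi>: "\<pi> \<in> policies D" and x: "x \<in> states D"
  shows "Limsup (at_left 1) (\<lambda>\<alpha>. ereal (1 - \<alpha>) * disc_cost D \<pi> \<alpha> x) \<le> avg_cost D \<pi> x"
proof (rule dense_ge)
  fix z assume z: "avg_cost D \<pi> x < z"
  show "Limsup (at_left 1) (\<lambda>\<alpha>. ereal (1 - \<alpha>) * disc_cost D \<pi> \<alpha> x) \<le> z"
  proof (cases z)
    case (real r)
    obtain L where L: "0 \<le> L" "\<And>z. z \<in> graph D \<Longrightarrow> ereal (- L) \<le> cost D z"
      using cost_lower_bound by blast
    define G where "G = mean_excess D \<pi> x L"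
    have "\<forall>\<^sub>F N in sequentially. ereal (1 / real N) * total_cost D \<pi> N x < ereal r"
      using z unfolding real avg_cost_def by (rule Limsup_lessD)
    then obtain N0 where N0: "\<And>N. N \<ge> N0 \<Longrightarrow> ereal (1 / real N) * total_cost D \<pi> N x < ereal r"
      by (auto simp: eventually_sequentially)
    \<comment> \<open>At \<open>N = 0\<close> the division by \<open>N\<close> would lose the information on the sum.\<close>
    define N1 where "N1 = max 1 N0"
    have S: "0 \<le> r + L \<and> (\<Sum>n<N. G n) \<le> ennreal ((r + L) * real N)" if "N \<ge> N1" for N
    proof -
      have N: "N \<ge> 1" "N \<ge> N0" using that by (auto simp: N1_def)
      have "ereal (1 / real N) * (enn2ereal (\<Sum>n<N. G n) - ereal (L * real N)) < ereal r"
        using N0[OF N(2)] total_cost_eq[OF \<pi> x L] by (simp add: G_def)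
      then obtain s where s: "(\<Sum>n<N. G n) = ennreal s" "0 \<le> s" "1 / real N * (s - L * real N) < r"
        using N(1) by (cases "\<Sum>n<N. G n") auto
      then have le: "s \<le> (r + L) * real N"
        using N(1) by (simp add: field_simps)
      then have "0 \<le> (r + L) * real N"
        using s(2) by linarith
      then have "0 \<le> r + L"
        using N(1) by (simp add: zero_le_mult_iff)
      then show ?thesis
        using le s by (simp add: ennreal_leI)
    qed
    have rL: "0 \<le> r + L"
      using S[of N1] by simp
    \<comment> \<open>Every term is finite, even a term of small index, since it is part of some long sum.\<close>
    have fin: "G n < top" for n
    proof -
      have "G n \<le> (\<Sum>k<max N1 (Suc n). G k)"
        by (rule member_le_sum) auto
      also have "\<dots> \<le> ennreal ((r + L) * real (max N1 (Suc n)))"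
        using S by simp
      finally show ?thesis
        using ennreal_less_top le_less_trans by blast
    qed
    define g where "g n = enn2real (G n)" for n
    have g: "0 \<le> g n" "G n = ennreal (g n)" for n
      using fin[of n] by (auto simp: g_def ennreal_enn2real)
    \<comment> \<open>The partial sums that the average does not control are bounded by the last of them.\<close>
    define C where "C = (\<Sum>n<N1. g n)"
    have C0: "0 \<le> C"
      by (simp add: C_def sum_nonneg g)
    have "(\<Sum>n<N. g n - (r + L)) \<le> C" for N
    proof (cases "N \<ge> N1")
      case True
      have "ennreal (\<Sum>n<N. g n) \<le> ennreal ((r + L) * real N)"
        using S[OF True] g by (simp add: sum_ennreal)
      then have "(\<Sum>n<N. g n) \<le> (r + L) * real N"
        using rL by (simp add: ennreal_le_iff)
      then show ?thesis
        using C0 by (simp add: sum_subtractf algebra_simps)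
    next
      case False
      then have "(\<Sum>n<N. g n) \<le> C"
        unfolding C_def by (intro sum_mono2) (auto simp: g)
      moreover have "0 \<le> real N * (r + L)"
        using rL by simp
      ultimately show ?thesis
        by (simp add: sum_subtractf)
    qed
    note partial = this
    have bound: "ereal (1 - \<alpha>) * disc_cost D \<pi> \<alpha> x \<le> ereal ((1 - \<alpha>) * C + r)"
      if \<alpha>: "0 < \<alpha>" "\<alpha> < 1" for \<alpha>
    proof -
      have "(\<Sum>n<N. ennreal (\<alpha> ^ n) * G n) \<le> ennreal (C + (r + L) / (1 - \<alpha>))" for N
      proof -
        have "(\<Sum>n<N. \<alpha> ^ n * (g n - (r + L))) \<le> C"
          using partial \<alpha> by (intro discounted_sum_le) auto
        then have "(\<Sum>n<N. \<alpha> ^ n * g n) \<le> C + (r + L) * (\<Sum>n<N. \<alpha> ^ n)"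
          by (simp add: right_diff_distrib sum_subtractf flip: sum_distrib_right) (simp add: mult.commute)
        also have "(\<Sum>n<N. \<alpha> ^ n) \<le> 1 / (1 - \<alpha>)"
          using \<alpha> sum_le_suminf[of "\<lambda>n. \<alpha> ^ n" "{..<N}"] suminf_geometric[of \<alpha>] summable_geometric[of \<alpha>]
          by simp
        finally have "(\<Sum>n<N. \<alpha> ^ n * g n) \<le> C + (r + L) / (1 - \<alpha>)"
          using rL by (simp add: mult_left_mono)
        moreover have "(\<Sum>n<N. ennreal (\<alpha> ^ n) * G n) = ennreal (\<Sum>n<N. \<alpha> ^ n * g n)"
          using \<alpha> g by (simp add: ennreal_mult'' sum_ennreal[symmetric])
        ultimately show ?thesis
          by (simp add: ennreal_leI)
      qed
      then have "(\<Sum>n. ennreal (\<alpha> ^ n) * G n) \<le> ennreal (C + (r + L) / (1 - \<alpha>))"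
        by (intro suminf_le_const summableI) auto
      moreover have "0 \<le> C + (r + L) / (1 - \<alpha>)"
        using C0 rL \<alpha> by simp
      ultimately have "enn2ereal (\<Sum>n. ennreal (\<alpha> ^ n) * G n) \<le> ereal (C + (r + L) / (1 - \<alpha>))"
        by (metis enn2ereal_ennreal less_eq_ennreal.rep_eq)
      then have "enn2ereal (\<Sum>n. ennreal (\<alpha> ^ n) * G n) - ereal (L / (1 - \<alpha>))
          \<le> ereal (C + (r + L) / (1 - \<alpha>)) - ereal (L / (1 - \<alpha>))"
        by (intro ereal_minus_mono) auto
      then have "disc_cost D \<pi> \<alpha> x \<le> ereal (C + (r + L) / (1 - \<alpha>)) - ereal (L / (1 - \<alpha>))"
        using disc_cost_eq[OF \<pi> x \<alpha> L] by (simp add: G_def)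
      then have "ereal (1 - \<alpha>) * disc_cost D \<pi> \<alpha> x
          \<le> ereal (1 - \<alpha>) * (ereal (C + (r + L) / (1 - \<alpha>)) - ereal (L / (1 - \<alpha>)))"
        using \<alpha> by (intro ereal_mult_left_mono) auto
      also have "\<dots> = ereal ((1 - \<alpha>) * C + r)"
        using \<alpha> by (simp add: distrib_left right_diff_distrib add_divide_distrib)
      finally show ?thesis .
    qed
    have "\<forall>\<^sub>F \<alpha> in at_left (1::real). 0 < \<alpha> \<and> \<alpha> < 1"
      using eventually_at_left_real[of 0 "1::real"] by simp
    then have "Limsup (at_left 1) (\<lambda>\<alpha>. ereal (1 - \<alpha>) * disc_cost D \<pi> \<alpha> x)
        \<le> Limsup (at_left 1) (\<lambda>\<alpha>. ereal ((1 - \<alpha>) * C + r))"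
      by (rule Limsup_mono[OF eventually_mono]) (auto intro: bound)
    also have "((\<lambda>\<alpha>. ereal ((1 - \<alpha>) * C + r)) \<longlongrightarrow> ereal ((1 - 1) * C + r)) (at_left 1)"
      by (intro tendsto_intros)
    then have "Limsup (at_left 1) (\<lambda>\<alpha>. ereal ((1 - \<alpha>) * C + r)) = ereal r"
      by (intro lim_imp_Limsup) (auto simp: trivial_limit_at_left_real)
    finally show ?thesis
      by (simp add: real)
  qed (use z in auto)
qed

lemma Limsup_disc_value_le_avg_value:
  assumes x: "x \<in> states D"
  shows "Limsup (at_left 1) (\<lambda>\<alpha>. ereal (1 - \<alpha>) * disc_value D \<alpha> x) \<le> avg_value D x"
  unfolding avg_value_def
proof (rule INF_greatest)
  fix \<pi> assume \<pi>: "\<pi> \<in> policies D"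
  have "\<forall>\<^sub>F \<alpha> in at_left (1::real). \<alpha> < 1"
    by (simp add: eventually_at_filter)
  then have "Limsup (at_left 1) (\<lambda>\<alpha>. ereal (1 - \<alpha>) * disc_value D \<alpha> x)
      \<le> Limsup (at_left 1) (\<lambda>\<alpha>. ereal (1 - \<alpha>) * disc_cost D \<pi> \<alpha> x)"
    by (intro Limsup_mono)
       (auto elim!: eventually_mono intro!: ereal_mult_left_mono INF_lower \<pi> simp: disc_value_def)
  also have "\<dots> \<le> avg_cost D \<pi> x"
    using \<pi> x by (rule Limsup_disc_cost_le_avg_cost)
  finally show "Limsup (at_left 1) (\<lambda>\<alpha>. ereal (1 - \<alpha>) * disc_value D \<alpha> x) \<le> avg_cost D \<pi> x" .
qed

lemma w_upper_le_Limsup_disc_value: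
  assumes x: "x \<in> states D"
  shows "w_upper D \<le> Limsup (at_left 1) (\<lambda>\<alpha>. ereal (1 - \<alpha>) * disc_value D \<alpha> x)"
proof -
  have "\<forall>\<^sub>F \<alpha> in at_left (1::real). \<alpha> < 1"
    by (simp add: eventually_at_filter)
  then show ?thesis
    unfolding w_upper_def
    by (intro Limsup_mono)
       (auto elim!: eventually_mono intro!: ereal_mult_left_mono INF_lower x simp: disc_min_def)
qed

end

section \<open>The average cost under the optimality inequality\<close>

context borel_mdp
begin

text \<open>
  Integrating the inequality along the trajectory gives
  \<open>E c(\<xi>\<^sub>n, u\<^sub>n) + E u(\<xi>\<^bsub>n+1\<^esub>) \<le> w + E u(\<xi>\<^sub>n)\<close>, and the sum over \<open>n\<close> telescopes. The last potential
  term is dropped because it is nonnegative.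
\<close>

lemma total_cost_stationary_le:
  fixes w :: real and u :: "'x \<Rightarrow> real"
  assumes \<phi>: "stationary_policy D \<phi>" and x: "x \<in> states D"
    and u[measurable]: "u \<in> borel_measurable (state_space D)" and u0: "\<And>y. y \<in> states D \<Longrightarrow> 0 \<le> u y"
    and ineq: "\<And>y. y \<in> states D \<Longrightarrow>
      cost D (y, \<phi> y) + enn2ereal (\<integral>\<^sup>+y'. ennreal (u y') \<partial>kernel D (y, \<phi> y)) \<le> ereal w + ereal (u y)"
  shows "total_cost D (stationary D \<phi>) N x \<le> ereal (real N * w + u x)"
proof -
  note \<pi> = stationary_in_policies[OF \<phi>]
  interpret prob_space "trajectory_law D (stationary D \<phi>) x"
    using \<pi> x by (rule prob_space_trajectory_law)
  obtain L where L0: "0 \<le> L" and wL: "- w \<le> L" and L: "\<And>z. z \<in> graph D \<Longrightarrow> ereal (- L) \<le> cost D z"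
    using cost_lower_bound[of "- w"] by blast
  define U where "U n = (\<integral>\<^sup>+\<omega>. ennreal (u (fst (\<omega> n))) \<partial>trajectory_law D (stationary D \<phi>) x)" for n
  define I where "I z = (\<integral>\<^sup>+y. ennreal (u y) \<partial>ext_kernel D z)" for z
  have mu: "(\<lambda>z. ennreal (u (fst z))) \<in> borel_measurable (step_space D)"
    unfolding step_space_def by measurable
  have mI: "I \<in> borel_measurable (step_space D)"
    unfolding I_def using measurable_prob_algebraD[OF measurable_ext_kernel]
    by (rule measurable_compose[OF _ nn_integral_measurable_subprob_algebra]) simp
  have m: "(\<lambda>\<omega>. h (\<omega> n)) \<in> borel_measurable (trajectory_law D (stationary D \<phi>) x)"
    if "h \<in> borel_measurable (step_space D)" for h :: "'x \<times> 'a \<Rightarrow> ennreal" and n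
    using measurable_compose[OF measurable_coordinate[OF \<pi> x] that] .
  let ?G = "mean_excess D (stationary D \<phi>) x L"
  have pointwise: "excess D L (y, \<phi> y) + I (y, \<phi> y) \<le> ennreal (w + L) + ennreal (u (fst (y, \<phi> y)))"
    if y: "y \<in> states D" for y
  proof -
    have gr: "(y, \<phi> y) \<in> graph D"
      using \<phi> y by (simp add: stationary_policy_def graph_def)
    then have "enn2ereal (excess D L (y, \<phi> y)) - ereal L + enn2ereal (I (y, \<phi> y)) \<le> ereal w + ereal (u y)"
      using ineq[OF y] by (simp add: cost_eq_excess[OF gr L[OF gr]] I_def ext_kernel_def)
    then show ?thesis
      using u0[OF y] wL
      by (cases "excess D L (y, \<phi> y)"; cases "I (y, \<phi> y)")
         (auto simp: ennreal_plus[symmetric] simp del: ennreal_plus)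
  qed
  have step: "?G n + U (Suc n) \<le> ennreal (w + L) + U n" for n
  proof -
    have "U (Suc n) = (\<integral>\<^sup>+\<omega>. I (\<omega> n) \<partial>trajectory_law D (stationary D \<phi>) x)"
      unfolding U_def using nn_integral_stationary_Suc[OF \<phi> x mu] by (simp add: I_def)
    then have "?G n + U (Suc n)
        = (\<integral>\<^sup>+\<omega>. excess D L (\<omega> n) + I (\<omega> n) \<partial>trajectory_law D (stationary D \<phi>) x)"
      by (simp add: mean_excess_def nn_integral_add m measurable_excess mI)
    also have "\<dots> \<le> (\<integral>\<^sup>+\<omega>. ennreal (w + L) + ennreal (u (fst (\<omega> n))) \<partial>trajectory_law D (stationary D \<phi>) x)"
      by (rule nn_integral_stationary_mono[OF \<phi> x, where h="\<lambda>z. excess D L z + I z"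
            and k="\<lambda>z. ennreal (w + L) + ennreal (u (fst z))"])
         (use pointwise in \<open>auto intro!: borel_measurable_add measurable_excess mI mu\<close>)
    also have "\<dots> = ennreal (w + L) + U n"
      by (simp add: U_def nn_integral_add m[OF mu] emeasure_space_1)
    finally show ?thesis .
  qed
  have tele: "(\<Sum>n<N. ?G n) + U N \<le> ennreal (real N * (w + L)) + U 0" for N
  proof (induction N)
    case (Suc N)
    have "(\<Sum>n<Suc N. ?G n) + U (Suc N) = (\<Sum>n<N. ?G n) + (?G N + U (Suc N))"
      by (simp add: add.assoc)
    also have "\<dots> \<le> (\<Sum>n<N. ?G n) + (ennreal (w + L) + U N)"
      using step by (intro add_left_mono)
    also have "\<dots> = ((\<Sum>n<N. ?G n) + U N) + ennreal (w + L)"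
      by (simp add: ac_simps)
    also have "\<dots> \<le> (ennreal (real N * (w + L)) + U 0) + ennreal (w + L)"
      using Suc.IH by (intro add_right_mono)
    also have "\<dots> = (ennreal (real N * (w + L)) + ennreal (w + L)) + U 0"
      by (simp add: ac_simps)
    also have "ennreal (real N * (w + L)) + ennreal (w + L) = ennreal (real (Suc N) * (w + L))"
      using ennreal_plus[of "real N * (w + L)" "w + L"] wL by (simp add: distrib_right add.commute)
    finally show ?case .
  qed simp
  have "(\<Sum>n<N. ?G n) \<le> (\<Sum>n<N. ?G n) + U N"
    by simp
  also have "\<dots> \<le> ennreal (real N * (w + L)) + U 0"
    by (rule tele)
  also have "U 0 = ennreal (u x)"
    unfolding U_def using nn_integral_stationary_0[OF \<phi> x mu] by simp
  also have "ennreal (real N * (w + L)) + ennreal (u x) = ennreal (real N * (w + L) + u x)"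
    using wL u0[OF x] by (intro ennreal_plus[symmetric] mult_nonneg_nonneg) auto
  finally have "enn2ereal (\<Sum>n<N. ?G n) \<le> ereal (real N * (w + L) + u x)"
    using wL u0[OF x] unfolding less_eq_ennreal.rep_eq by (subst (asm) enn2ereal_ennreal) simp_all
  then have "enn2ereal (\<Sum>n<N. ?G n) - ereal (L * real N)
      \<le> ereal (real N * (w + L) + u x) - ereal (L * real N)"
    by (intro ereal_minus_mono) auto
  then have "total_cost D (stationary D \<phi>) N x \<le> ereal (real N * (w + L) + u x) - ereal (L * real N)"
    using total_cost_eq[OF \<pi> x L0 L] by simp
  then show ?thesis
    by (simp add: algebra_simps)
qed

lemma avg_cost_stationary_le:
  fixes w :: real and u :: "'x \<Rightarrow> real"
  assumes "stationary_policy D \<phi>" and "x \<in> states D"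
    and "u \<in> borel_measurable (state_space D)" and "\<And>y. y \<in> states D \<Longrightarrow> 0 \<le> u y"
    and "\<And>y. y \<in> states D \<Longrightarrow>
      cost D (y, \<phi> y) + enn2ereal (\<integral>\<^sup>+y'. ennreal (u y') \<partial>kernel D (y, \<phi> y)) \<le> ereal w + ereal (u y)"
  shows "avg_cost D (stationary D \<phi>) x \<le> ereal w"
proof -
  have le: "ereal (1 / real N) * total_cost D (stationary D \<phi>) N x \<le> ereal (w + u x / real N)"
    if "N \<ge> 1" for N
  proof -
    have "ereal (1 / real N) * total_cost D (stationary D \<phi>) N x
        \<le> ereal (1 / real N) * ereal (real N * w + u x)"
      using total_cost_stationary_le[OF assms] by (intro ereal_mult_left_mono) auto
    also have "\<dots> = ereal (w + u x / real N)"
      using that by (simp add: field_simps)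
    finally show ?thesis .
  qed
  have "avg_cost D (stationary D \<phi>) x \<le> limsup (\<lambda>N. ereal (w + u x / real N))"
    unfolding avg_cost_def
    by (intro Limsup_mono) (use le in \<open>auto simp: eventually_sequentially intro!: exI[of _ 1]\<close>)
  also have "(\<lambda>N. ereal (w + u x / real N)) \<longlonglongrightarrow> ereal (w + 0)"
    by (intro tendsto_intros lim_const_over_n)
  then have "limsup (\<lambda>N. ereal (w + u x / real N)) = ereal w"
    by (intro lim_imp_Limsup) auto
  finally show ?thesis .
qed

end

section \<open>Optimality of the stationary policy\<close>

theorem theorem3p1:
  fixes D :: "('x::polish_space, 'a::polish_space) mdp"
    and u :: "'x \<Rightarrow> real" and \<phi> :: "'x \<Rightarrow> 'a"
  assumes "borel_mdp D"
    and "w_star D < \<infinity>"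
    and "u \<in> borel_measurable (state_space D)" and "\<And>x. x \<in> states D \<Longrightarrow> 0 \<le> u x"
    and "stationary_policy D \<phi>"
    and "\<And>x. x \<in> states D \<Longrightarrow>
           w_upper D + ereal (u x)
             \<ge> cost D (x, \<phi> x) + enn2ereal (\<integral>\<^sup>+y. ennreal (u y) \<partial>kernel D (x, \<phi> x))"
  shows "avg_optimal D (stationary D \<phi>) \<and>
         (\<forall>x\<in>states D.
            avg_value D x = avg_cost D (stationary D \<phi>) x \<and>
            avg_cost D (stationary D \<phi>) x
              = Limsup (at_left 1) (\<lambda>\<alpha>. ereal (1 - \<alpha>) * disc_value D \<alpha> x) \<and>
            Limsup (at_left 1) (\<lambda>\<alpha>. ereal (1 - \<alpha>) * disc_value D \<alpha> x) = w_upper D \<and>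
            w_upper D = w_star D)"
proof -
  interpret borel_mdp D by (rule assms(1))
  let ?l = "\<lambda>x. Limsup (at_left 1) (\<lambda>\<alpha>. ereal (1 - \<alpha>) * disc_value D \<alpha> x)"
  note pol = stationary_in_policies[OF assms(5)]
  have lower: "w_upper D \<le> ?l x" "?l x \<le> avg_value D x" "avg_value D x \<le> avg_cost D (stationary D \<phi>) x"
    if "x \<in> states D" for x
    using w_upper_le_Limsup_disc_value[OF that] Limsup_disc_value_le_avg_value[OF that] pol
    by (auto simp: avg_value_def intro: INF_lower)
  have le_star: "w_upper D \<le> w_star D"
    unfolding w_star_def using lower by (intro INF_greatest) (blast intro: order_trans)
  \<comment> \<open>With no state at all, the infimum \<open>w_star D\<close> would be \<open>\<infinity>\<close>.\<close>
  obtain x0 where x0: "x0 \<in> states D"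
  proof (cases "states D = {}")
    case True
    then show ?thesis
      using assms(2) by (simp add: w_star_def top_ereal_def)
  qed blast
  \<comment> \<open>A value \<open>- \<infinity>\<close> would, by the optimality inequality, force the cost \<open>- \<infinity>\<close> at \<open>x0\<close>.\<close>
  have "w_upper D \<noteq> - \<infinity>"
  proof
    assume "w_upper D = - \<infinity>"
    moreover obtain K :: real where "ereal K \<le> cost D (x0, \<phi> x0)"
      using cost_bounded_below assms(5) x0 by (auto simp: stationary_policy_def graph_def)
    moreover have "0 \<le> enn2ereal (\<integral>\<^sup>+y. ennreal (u y) \<partial>kernel D (x0, \<phi> x0))"
      by simp
    ultimately show False
      using assms(6)[OF x0]
      by (cases "cost D (x0, \<phi> x0)"; cases "enn2ereal (\<integral>\<^sup>+y. ennreal (u y) \<partial>kernel D (x0, \<phi> x0))") auto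
  qed
  then obtain w where w: "w_upper D = ereal w"
    using le_star assms(2) by (cases "w_upper D") auto
  have upper: "avg_cost D (stationary D \<phi>) x \<le> w_upper D" if "x \<in> states D" for x
    unfolding w
    by (rule avg_cost_stationary_le[OF assms(5) that assms(3,4)]) (use assms(6) w in auto)
  have eq: "avg_value D x = w_upper D" "?l x = w_upper D" "avg_cost D (stationary D \<phi>) x = w_upper D"
    if "x \<in> states D" for x
    using lower[OF that] upper[OF that] by auto
  have "w_star D \<le> w_upper D"
    unfolding w_star_def using eq(1)[OF x0] x0 by (auto intro: INF_lower2)
  then have "w_upper D = w_star D"
    using le_star by simp
  then show ?thesis
    using eq pol by (auto simp: avg_optimal_def)
qed

end
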